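(* Let $|q|<1$ and let $f(-q)=(q;q)_\infty=\prod_{k\ge 1}(1-q^k)$. Set $$P=\frac{f(-q)f(-q^{4})}{q^{5/6}f(-q^{5})f(-q^{20})},\qquad Q=\frac{f(-q^2)^2}{q^{2/3}f(-q^{10})^2},$$ and write $w=\left(\frac{P}{Q}\right)^3+\left(\frac{Q}{P}\right)^3$ and $C=PQ+\frac{25}{PQ}$. Then $$C^2=C\left(w^3+6w\right)-w^4-37w^2+64.$$
   Context: $(a;q)_\infty=\prod_{n\ge0}(1-aq^n)$. Fractional powers of $q$ are taken consistently, e.g. writing $q=e^{2\pi i\tau}$ with $\operatorname{Im}\tau>0$ and $q^r=e^{2\pi i r\tau}$. *)

theory Defs
  imports "HOL-Analysis.Analysis"
begin

text \<open>The infinite q-shifted factorial. For |q| < 1 the product converges.\<close>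

definition qpoch_inf :: "complex \<Rightarrow> complex \<Rightarrow> complex" where
  "qpoch_inf a q = prodinf (\<lambda>n. 1 - a * q ^ n)"

lemma convergent_prod_qpoch_inf:
  fixes a q :: complex
  assumes "norm q < 1"
  shows "convergent_prod (\<lambda>n. 1 - a * q ^ n)"
proof -
  have "summable (\<lambda>n. norm (a * q ^ n))"
    unfolding norm_mult norm_power using assms by (intro summable_mult summable_geometric) simp
  hence "abs_convergent_prod (\<lambda>n. 1 - a * q ^ n)"
    by (subst abs_convergent_prod_conv_summable) simp
  thus ?thesis
    by (rule abs_convergent_prod_imp_convergent_prod)
qed

text \<open>Ramanujan's function f of one variable, normalised by f(-q) = (q;q), so that
  \<open>ramanujan_f (- (q ^ k))\<close> is the product of the \<open>1 - q ^ (k * n)\<close> over \<open>n \<ge> 1\<close>.\<close>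

definition ramanujan_f :: "complex \<Rightarrow> complex" where
  "ramanujan_f x = qpoch_inf (- x) (- x)"

text \<open>Fractional powers of the nome: \<open>qpow \<tau> r\<close> is \<open>q\<^sup>r\<close> where \<open>q = exp (2 \<pi> i \<tau>)\<close>. As \<open>\<tau>\<close>
  ranges over the upper half-plane, this covers every q with 0 < |q| < 1 and every consistent
  choice of its roots. (It is not \<open>q powr r\<close>, which uses the principal branch.)\<close>

definition qpow :: "complex \<Rightarrow> real \<Rightarrow> complex" where
  "qpow \<tau> r = exp (2 * of_real pi * \<i> * of_real r * \<tau>)"

end

theory Submission
  imports Defs
begin

text \<open>Write \<open>\<phi>(q) = \<Sum>\<^sub>n q ^ n\<^sup>2\<close> and \<open>\<chi>(q) = (-q;q\<^sup>2)\<close>. The Gaussian integers form the union of the ideal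
  generated by \<open>2 + i\<close> and four cosets that the units permute, so a sum of
  \<open>q ^ (a\<^sup>2 + b\<^sup>2)\<close>, weighted by a function of the class of \<open>a + b i\<close>, only involves the sum \<open>\<phi>(q\<^sup>5)\<^sup>2\<close> over the
  ideal and the common sum over the other cosets, which factors into two theta series. With
  constant weight and with weight a nontrivial additive character, and with the Jacobi triple product,
  this gives \<open>\<phi>(q)\<^sup>2 - \<phi>(q\<^sup>5)\<^sup>2 = 4 q f(-q\<^sup>1\<^sup>0)\<^sup>2 \<chi>(q) / \<chi>(q\<^sup>5)\<close> and
  \<open>5 \<phi>(q\<^sup>5)\<^sup>2 - \<phi>(q)\<^sup>2 = 4 f(-q\<^sup>2)\<^sup>2 \<chi>(q\<^sup>5) / \<chi>(q)\<close>. In terms of \<open>m = \<phi>(q)\<^sup>2 / \<phi>(q\<^sup>5)\<^sup>2\<close> and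
  \<open>x = (P/Q)\<^sup>3\<close> they say that \<open>x\<^sup>2 m (m - 1) = 5 - m\<close>, while \<open>P Q = m\<^sup>2 x\<^sup>3\<close>. The conjugate \<open>C'\<close> of \<open>C\<close> under
  exchange of the two roots \<open>m\<close> of this quadratic satisfies \<open>C + C' = w\<^sup>3 + 6 w\<close> and
  \<open>C C' = w\<^sup>4 + 37 w\<^sup>2 - 64\<close>.\<close>

subsection \<open>Infinite q-shifted factorials\<close>

lemma qpoch_inf_has_prod:
  assumes "norm q < 1"
  shows "(\<lambda>n. 1 - a * q ^ n) has_prod qpoch_inf a q"
  unfolding qpoch_inf_def using convergent_prod_qpoch_inf[OF assms] by (rule convergent_prod_has_prod)

lemma qpoch_inf_LIMSEQ:
  assumes "norm q < 1"
  shows "(\<lambda>n. \<Prod>k<n. 1 - a * q ^ k) \<longlonglongrightarrow> qpoch_inf a q"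
  using has_prod_imp_tendsto'[OF qpoch_inf_has_prod[OF assms]] .

lemma qpoch_inf_nonzero:
  assumes "norm q < 1" "norm a < 1"
  shows "qpoch_inf a q \<noteq> 0"
proof -
  have "1 - a * q ^ n \<noteq> 0" for n
  proof
    assume "1 - a * q ^ n = 0"
    hence "norm (a * q ^ n) = 1" by (metis eq_iff_diff_eq_0 norm_one)
    moreover have "norm (a * q ^ n) \<le> norm a * 1"
      unfolding norm_mult norm_power using assms by (intro mult_left_mono power_le_one) auto
    ultimately show False using assms by simp
  qed
  thus ?thesis
    unfolding qpoch_inf_def using convergent_prod_qpoch_inf[OF assms(1)] by (intro prodinf_nonzero)
qed

text \<open>Partial products of length \<open>n * m\<close> split according to the residue of the
  exponent modulo \<open>m\<close>. Both sides are limits of these products.\<close>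

lemma qpoch_inf_dissect:
  assumes "norm q < 1" "m > 0"
  shows "qpoch_inf a q = (\<Prod>i<m. qpoch_inf (a * q ^ i) (q ^ m))"
proof (rule LIMSEQ_unique)
  have "norm (q ^ m) < 1" using assms by (simp add: norm_power power_less_one_iff)
  thus "(\<lambda>n. \<Prod>i<m. \<Prod>k<n. 1 - a * q ^ i * (q ^ m) ^ k) \<longlonglongrightarrow> (\<Prod>i<m. qpoch_inf (a * q ^ i) (q ^ m))"
    by (intro tendsto_prod qpoch_inf_LIMSEQ)
  have "(\<lambda>n. \<Prod>k<n * m. 1 - a * q ^ k) \<longlonglongrightarrow> qpoch_inf a q"
    using filterlim_compose[OF qpoch_inf_LIMSEQ[OF assms(1)] mult_nat_right_at_top[of m]] assms by simp
  also have "(\<lambda>n. \<Prod>k<n * m. 1 - a * q ^ k) = (\<lambda>n. \<Prod>i<m. \<Prod>k<n. 1 - a * q ^ i * (q ^ m) ^ k)"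
  proof
    fix n
    have "(\<Prod>i<m. \<Prod>k<n. 1 - a * q ^ i * (q ^ m) ^ k) = (\<Prod>k<n. \<Prod>i<m. 1 - a * q ^ i * (q ^ m) ^ k)"
      by (rule prod.swap)
    also have "\<dots> = (\<Prod>k<n. \<Prod>i\<in>{k*m..<k*m+m}. 1 - a * q ^ i)"
    proof (rule prod.cong[OF refl])
      fix k
      have "(\<Prod>i\<in>{k*m..<k*m+m}. 1 - a * q ^ i) = (\<Prod>i\<in>{0..<m}. 1 - a * q ^ (i + k*m))"
        using prod.shift_bounds_nat_ivl[of "\<lambda>i. 1 - a * q ^ i" 0 "k*m" m] by (simp add: add.commute)
      thus "(\<Prod>i<m. 1 - a * q ^ i * (q ^ m) ^ k) = (\<Prod>i\<in>{k*m..<k*m+m}. 1 - a * q ^ i)"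
        by (simp add: power_add power_mult mult.commute[of k m] mult.assoc atLeast0LessThan)
    qed
    also have "\<dots> = (\<Prod>k<n * m. 1 - a * q ^ k)"
      by (rule prod.nat_group)
    finally show "(\<Prod>k<n * m. 1 - a * q ^ k) = (\<Prod>i<m. \<Prod>k<n. 1 - a * q ^ i * (q ^ m) ^ k)" ..
  qed
  finally show "(\<lambda>n. \<Prod>i<m. \<Prod>k<n. 1 - a * q ^ i * (q ^ m) ^ k) \<longlonglongrightarrow> qpoch_inf a q" .
qed

lemma qpoch_inf_mult_uminus:
  assumes "norm q < 1"
  shows "qpoch_inf a q * qpoch_inf (- a) q = qpoch_inf (a\<^sup>2) (q\<^sup>2)"
proof (rule LIMSEQ_unique)
  show "(\<lambda>n. (\<Prod>k<n. 1 - a * q ^ k) * (\<Prod>k<n. 1 - (- a) * q ^ k)) \<longlonglongrightarrow> qpoch_inf a q * qpoch_inf (- a) q"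
    by (intro tendsto_mult qpoch_inf_LIMSEQ assms)
  have "norm (q\<^sup>2) < 1" using assms by (simp add: norm_power power_less_one_iff)
  hence "(\<lambda>n. \<Prod>k<n. 1 - a\<^sup>2 * (q\<^sup>2) ^ k) \<longlonglongrightarrow> qpoch_inf (a\<^sup>2) (q\<^sup>2)"
    by (rule qpoch_inf_LIMSEQ)
  moreover have "1 - a\<^sup>2 * (q\<^sup>2) ^ k = (1 - a * q ^ k) * (1 - (- a) * q ^ k)" for k
    by (simp add: algebra_simps power_mult [symmetric] power2_eq_square mult_2 power_add)
  ultimately show "(\<lambda>n. (\<Prod>k<n. 1 - a * q ^ k) * (\<Prod>k<n. 1 - (- a) * q ^ k)) \<longlonglongrightarrow> qpoch_inf (a\<^sup>2) (q\<^sup>2)"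
    by (simp add: prod.distrib)
qed

subsection \<open>The Jacobi triple product\<close>

text \<open>The Gaussian binomial coefficient. The form \<open>q * q ^ i\<close> matches the factors
  of \<open>qpoch_inf q q\<close>. The value 0 for \<open>k > n\<close> avoids the truncated
  difference \<open>n - k\<close> and makes Pascal's rule hold at \<open>k = n\<close>.\<close>

definition qbinom :: "complex \<Rightarrow> nat \<Rightarrow> nat \<Rightarrow> complex" where
  "qbinom q n k = (if k \<le> n
     then (\<Prod>i<n. 1 - q * q ^ i) / ((\<Prod>i<k. 1 - q * q ^ i) * (\<Prod>i<n-k. 1 - q * q ^ i)) else 0)"

lemma one_minus_power_nonzero:
  fixes q :: complex
  assumes "norm q < 1"
  shows "1 - q * q ^ i \<noteq> 0"
proof
  assume "1 - q * q ^ i = 0"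
  hence "norm (q ^ Suc i) = 1" by (metis eq_iff_diff_eq_0 norm_one power_Suc)
  moreover have "norm (q ^ Suc i) < 1"
    unfolding norm_power using assms by (subst power_less_one_iff) auto
  ultimately show False by simp
qed

text \<open>Of the two q-Pascal rules this is the one whose power \<open>q ^ (n - k)\<close>
  combines with the square exponents in \<open>qbinom_theorem\<close>.\<close>

lemma qbinom_Suc_Suc:
  assumes "norm q < 1" "k \<le> n"
  shows "qbinom q (Suc n) (Suc k) = qbinom q n (Suc k) + q ^ (n - k) * qbinom q n k"
proof (cases "k = n")
  case True
  thus ?thesis using one_minus_power_nonzero[OF assms(1)] by (simp add: qbinom_def)
next
  case False
  then obtain d where n: "n = Suc (k + d)"
    using assms(2) by (metis add_Suc_right le_neq_implies_less less_imp_Suc_add)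
  define p where "p = (\<lambda>n. \<Prod>i<n. 1 - q * q ^ i)"
  have p: "p n \<noteq> 0" for n
    using one_minus_power_nonzero[OF assms(1)] by (simp add: p_def)
  have pS: "p (Suc n) = p n * (1 - q * q ^ n)" for n by (simp add: p_def)
  have nz: "1 - q * q ^ n \<noteq> 0" for n using one_minus_power_nonzero[OF assms(1)] .
  \<comment> \<open>Over a common denominator this is \<open>1 - q ^ (n + 1) = (1 - q ^ (d + 1)) + q
    ^ (d + 1) * (1 - q ^ (k + 1))\<close>, where \<open>n = k + d + 1\<close>.\<close>
  have "p (Suc n) / (p (Suc k) * p (Suc d)) = p n / (p (Suc k) * p d) + q * q ^ d * (p n / (p k * p (Suc d)))"
    using p nz[of d] nz[of k] unfolding pS by (simp add: n divide_simps) (simp add: algebra_simps power_add)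
  thus ?thesis using n by (simp add: qbinom_def p_def)
qed

text \<open>Induction on \<open>n\<close>: the new factor adds \<open>y * q ^ (2 * n + 1)\<close>
  times the old sum, and Pascal's rule in base \<open>q\<^sup>2\<close> merges the two sums term by
  term.\<close>

lemma qbinom_theorem:
  assumes "norm q < 1"
  shows "(\<Prod>k<n. 1 + y * q ^ (2 * k + 1)) = (\<Sum>j\<le>n. qbinom (q\<^sup>2) n j * q ^ (j\<^sup>2) * y ^ j)"
proof (induction n)
  case 0
  show ?case by (simp add: qbinom_def)
next
  case (Suc n)
  have q2: "norm (q\<^sup>2) < 1" using assms by (simp add: norm_power power_less_one_iff)
  define t where "t = (\<lambda>n j. qbinom (q\<^sup>2) n j * q ^ (j\<^sup>2) * y ^ j)"
  have t0: "t n 0 = 1" for n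
    using one_minus_power_nonzero[OF q2] by (simp add: t_def qbinom_def)
  have step: "t (Suc n) (Suc j) = t n (Suc j) + t n j * (y * q ^ (2 * n + 1))" if "j \<le> n" for j
  proof -
    have "2 * (n - j) + (Suc j)\<^sup>2 = j\<^sup>2 + (2 * n + 1)"
      using that by (simp add: power2_eq_square)
    hence e: "(q\<^sup>2) ^ (n - j) * q ^ (Suc j)\<^sup>2 = q ^ j\<^sup>2 * q ^ (2 * n + 1)"
      by (metis power_add power_mult)
    have "t (Suc n) (Suc j) = t n (Suc j) + qbinom (q\<^sup>2) n j * ((q\<^sup>2) ^ (n - j) * q ^ (Suc j)\<^sup>2) * y ^ Suc j"
      unfolding t_def qbinom_Suc_Suc[OF q2 that] by (simp add: algebra_simps)
    thus ?thesis unfolding e by (simp add: t_def algebra_simps)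
  qed
  have "(\<Sum>j\<le>Suc n. t (Suc n) j) = 1 + (\<Sum>j\<le>n. t (Suc n) (Suc j))"
    by (subst sum.atMost_Suc_shift) (simp add: t0)
  also have "(\<Sum>j\<le>n. t (Suc n) (Suc j)) = (\<Sum>j\<le>n. t n (Suc j)) + (\<Sum>j\<le>n. t n j) * (y * q ^ (2 * n + 1))"
    by (simp add: step sum.distrib sum_distrib_right)
  also have "1 + \<dots> = (\<Sum>j\<le>Suc n. t n j) + (\<Sum>j\<le>n. t n j) * (y * q ^ (2 * n + 1))"
    by (simp add: sum.atMost_Suc_shift[of "t n" n] t0 del: sum.atMost_Suc)
  \<comment> \<open>The extra term vanishes because \<open>qbinom\<close> is 0 above the
    diagonal.\<close>
  also have "(\<Sum>j\<le>Suc n. t n j) = (\<Sum>j\<le>n. t n j)"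
    by (simp add: t_def qbinom_def)
  finally show ?case
    using Suc by (simp add: t_def algebra_simps)
qed

text \<open>The q-binomial theorem for \<open>2 n\<close> factors, at \<open>y = z / q ^ (2 n)\<close>.\<close>

lemma finite_jacobi_triple:
  assumes "norm q < 1" "q \<noteq> 0" "z \<noteq> 0"
  shows "(\<Prod>k<n. 1 - (- (z * q)) * (q\<^sup>2) ^ k) * (\<Prod>k<n. 1 - (- (q / z)) * (q\<^sup>2) ^ k) =
         (\<Sum>j\<le>2*n. qbinom (q\<^sup>2) (2 * n) j * (z powi (int j - int n) * q powi (int j - int n)\<^sup>2))"
proof -
  define y where "y = z / q ^ (2 * n)"
  have "(\<Prod>k<2*n. 1 + y * q ^ (2 * k + 1)) =
        (\<Prod>k<n. 1 + y * q ^ (2 * k + 1)) * (\<Prod>k\<in>{n..<n+n}. 1 + y * q ^ (2 * k + 1))"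
    unfolding lessThan_atLeast0 by (simp add: prod.atLeastLessThan_concat mult_2)
  also have "(\<Prod>k\<in>{n..<n+n}. 1 + y * q ^ (2 * k + 1)) = (\<Prod>k<n. 1 + y * q ^ (2 * (k + n) + 1))"
    using prod.shift_bounds_nat_ivl[of "\<lambda>k. 1 + y * q ^ (2 * k + 1)" 0 n n]
    by (simp add: lessThan_atLeast0)
  also have "\<dots> = (\<Prod>k<n. 1 - (- (z * q)) * (q\<^sup>2) ^ k)"
    by (intro prod.cong refl) (use assms in \<open>simp add: y_def power_add field_simps flip: power_mult\<close>)
  \<comment> \<open>Reversed, the lower half has the factors \<open>1 + z / q ^ (2 * k + 1)\<close>;
    pulling out \<open>z / q ^ (2 * k + 1)\<close> leaves the factors with
    \<open>q / z\<close>.\<close>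
  also have "(\<Prod>k<n. 1 + y * q ^ (2 * k + 1)) = (\<Prod>k<n. 1 + y * q ^ (2 * (n - Suc k) + 1))"
    by (rule prod.nat_diff_reindex[symmetric])
  also have "\<dots> = (\<Prod>k<n. (z / q ^ (2 * k + 1)) * (1 - (- (q / z)) * (q\<^sup>2) ^ k))"
  proof (intro prod.cong refl)
    fix k assume "k \<in> {..<n}"
    then obtain d where n: "n = Suc (k + d)" using less_imp_Suc_add by auto
    show "1 + y * q ^ (2 * (n - Suc k) + 1) = (z / q ^ (2 * k + 1)) * (1 - (- (q / z)) * (q\<^sup>2) ^ k)"
      using assms by (simp add: y_def n field_simps power_add power2_eq_square flip: power_mult)
        (simp add: power_mult power2_eq_square power_mult_distrib)
  qed
  also have "\<dots> = z ^ n / q ^ (n\<^sup>2) * (\<Prod>k<n. 1 - (- (q / z)) * (q\<^sup>2) ^ k)"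
  proof -
    have "(\<Sum>k<n. 2 * k + 1) = n\<^sup>2"
      by (induction n) (auto simp: power2_eq_square)
    thus ?thesis
      by (simp only: prod.distrib prod_dividef power_sum[symmetric] prod_constant card_lessThan)
  qed
  finally have "z ^ n / q ^ (n\<^sup>2) *
      ((\<Prod>k<n. 1 - (- (z * q)) * (q\<^sup>2) ^ k) * (\<Prod>k<n. 1 - (- (q / z)) * (q\<^sup>2) ^ k)) =
      (\<Sum>j\<le>2*n. qbinom (q\<^sup>2) (2 * n) j * q ^ (j\<^sup>2) * y ^ j)"
    unfolding qbinom_theorem[OF assms(1)] by (simp add: mult_ac)
  also have "\<dots> = (\<Sum>j\<le>2*n. z ^ n / q ^ (n\<^sup>2) *
      (qbinom (q\<^sup>2) (2 * n) j * (z powi (int j - int n) * q powi (int j - int n)\<^sup>2)))"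
  proof (intro sum.cong refl)
    fix j
    \<comment> \<open>Completing the square: \<open>y ^ j\<close> contributes the exponent
      \<open>- 2 * n * j\<close>, and the factor pulled out of the product contributes
      \<open>n\<^sup>2\<close>.\<close>
    have "(int j - int n)\<^sup>2 = int (j\<^sup>2) + int (n\<^sup>2) - int (2 * n * j)"
      by (simp add: power2_eq_square algebra_simps)
    hence "q powi (int j - int n)\<^sup>2 = q powi int (j\<^sup>2) * q powi int (n\<^sup>2) / q powi int (2 * n * j)"
      using assms by (simp only: power_int_diff power_int_add simp_thms)
    hence "q powi (int j - int n)\<^sup>2 = q ^ (j\<^sup>2) * q ^ (n\<^sup>2) / (q ^ (2 * n)) ^ j"
      by (simp only: power_int_of_nat power_mult)
    moreover have "z powi (int j - int n) = z ^ j / z ^ n"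
      using assms by (simp add: power_int_diff)
    ultimately show "qbinom (q\<^sup>2) (2 * n) j * q ^ (j\<^sup>2) * y ^ j = z ^ n / q ^ (n\<^sup>2) *
      (qbinom (q\<^sup>2) (2 * n) j * (z powi (int j - int n) * q powi (int j - int n)\<^sup>2))"
      using assms by (simp add: y_def power_divide)
  qed
  finally show ?thesis
    unfolding sum_distrib_left[symmetric] using assms by simp
qed

text \<open>The sum is unconditional, so that double sums can be reindexed by maps of the
  lattice.\<close>

definition theta :: "complex \<Rightarrow> complex \<Rightarrow> complex" where
  "theta z q = (\<Sum>\<^sub>\<infinity>n. z powi n * q powi n\<^sup>2)"

text \<open>The ratio of consecutive terms tends to 0 on the nonnegative half; the other half is the
  same series at \<open>inverse z\<close>.\<close>

lemma theta_summable_on: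
  fixes q z :: complex
  assumes "norm q < 1" "q \<noteq> 0" "z \<noteq> 0"
  shows "(\<lambda>n. z powi n * q powi n\<^sup>2) summable_on UNIV"
proof -
  have half: "(\<lambda>n. z ^ n * q ^ n\<^sup>2) summable_on UNIV" for z :: complex
  proof (rule norm_summable_imp_summable_on)
    have "(\<lambda>n. norm z * (norm q * norm (q\<^sup>2) ^ n)) \<longlonglongrightarrow> norm z * (norm q * 0)"
      using assms(1) by (intro tendsto_intros LIMSEQ_power_zero) (simp_all add: norm_power power_less_one_iff)
    hence "\<forall>\<^sub>F n in sequentially. norm z * (norm q * norm (q\<^sup>2) ^ n) < 1 / 2"
      by (rule order_tendstoD) simp
    then obtain N where N: "\<And>n. n \<ge> N \<Longrightarrow> norm z * (norm q * norm (q\<^sup>2) ^ n) < 1 / 2"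
      by (auto simp: eventually_sequentially)
    show "summable (\<lambda>n. norm (z ^ n * q ^ n\<^sup>2))"
    proof (rule summable_ratio_test[of "1 / 2" N])
      fix n assume n: "n \<ge> N"
      have "(Suc n)\<^sup>2 = n\<^sup>2 + 2 * n + 1" by (simp add: power2_eq_square)
      hence "norm (z ^ Suc n * q ^ (Suc n)\<^sup>2) =
          norm z * (norm q * norm (q\<^sup>2) ^ n) * norm (z ^ n * q ^ n\<^sup>2)"
        by (simp add: norm_mult norm_power power_add power_mult)
      also have "\<dots> \<le> 1 / 2 * norm (z ^ n * q ^ n\<^sup>2)"
        by (rule mult_right_mono[OF less_imp_le[OF N[OF n]]]) simp
      finally show "norm (norm (z ^ Suc n * q ^ (Suc n)\<^sup>2)) \<le> 1 / 2 * norm (norm (z ^ n * q ^ n\<^sup>2))"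
        by simp
    qed simp
  qed
  show ?thesis
  proof (rule summable_on_subset_banach)
    have "(\<lambda>n. z powi n * q powi n\<^sup>2) summable_on range int"
      using half[of z] by (subst summable_on_reindex) (auto simp: o_def simp flip: of_nat_power)
    moreover have "(\<lambda>n. z powi n * q powi n\<^sup>2) summable_on range (\<lambda>n. - int n)"
      using half[of "inverse z"]
      by (subst summable_on_reindex)
         (auto simp: o_def inj_on_def power_int_minus power_inverse simp flip: of_nat_power)
    ultimately show "(\<lambda>n. z powi n * q powi n\<^sup>2) summable_on (range int \<union> range (\<lambda>n. - int n))"
      by (rule summable_on_union)
    show "UNIV \<subseteq> range int \<union> range (\<lambda>n. - int n)"
    proof
      fix n show "n \<in> range int \<union> range (\<lambda>n. - int n)" by (cases n rule: int_cases2) auto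
    qed
  qed
qed

text \<open>Limit of \<open>finite_jacobi_triple\<close> by Tannery's theorem: the Gaussian
  coefficients are uniformly bounded and tend to the inverse of
  \<open>qpoch_inf (q\<^sup>2) (q\<^sup>2)\<close>.\<close>

theorem jacobi_triple_product:
  assumes "norm q < 1" "q \<noteq> 0" "z \<noteq> 0"
  shows "theta z q = qpoch_inf (q\<^sup>2) (q\<^sup>2) * qpoch_inf (- (z * q)) (q\<^sup>2) * qpoch_inf (- (q / z)) (q\<^sup>2)"
proof -
  define f where "f = (\<lambda>n. z powi n * q powi n\<^sup>2)"
  define p where "p = (\<lambda>n. \<Prod>i<n. 1 - q\<^sup>2 * (q\<^sup>2) ^ i)"
  \<comment> \<open>The coefficients of the finite identity, centred at 0 and extended by zero to
    all integers.\<close>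
  define c where "c = (\<lambda>N n. if - int N \<le> n \<and> n \<le> int N then qbinom (q\<^sup>2) (2 * N) (nat (n + int N)) else 0)"
  let ?L = "qpoch_inf (q\<^sup>2) (q\<^sup>2)"
  have q2: "norm (q\<^sup>2) < 1" using assms by (simp add: norm_power power_less_one_iff)
  have L: "?L \<noteq> 0" using qpoch_inf_nonzero[OF q2 q2] .
  have p: "p n \<noteq> 0" for n using one_minus_power_nonzero[OF q2] by (simp add: p_def)
  have plim: "p \<longlonglongrightarrow> ?L" unfolding p_def by (rule qpoch_inf_LIMSEQ[OF q2])
  \<comment> \<open>Since \<open>p\<close> converges to a nonzero limit, both \<open>p\<close> and
    its inverse are bounded, which gives the dominating constant \<open>A * B * B\<close>.\<close>
  obtain A where A: "norm (p n) \<le> A" for n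
    using convergent_imp_Bseq[OF convergentI[OF plim]] by (auto simp: Bseq_def)
  obtain B where B: "norm (inverse (p n)) \<le> B" for n
    using convergent_imp_Bseq[OF convergentI[OF tendsto_inverse[OF plim L]]] by (auto simp: Bseq_def)
  have c_eq: "c N n = p (2 * N) * inverse (p (nat (int N + n))) * inverse (p (nat (int N - n)))"
    if "- int N \<le> n" "n \<le> int N" for N n
  proof -
    have "nat (n + int N) \<le> 2 * N" "2 * N - nat (n + int N) = nat (int N - n)" using that by auto
    thus ?thesis using that by (simp add: c_def qbinom_def p_def field_simps)
  qed
  have A0: "A \<ge> 0" and B0: "B \<ge> 0" using A[of 0] B[of 0] norm_ge_zero order_trans by blast+
  have c_bound: "norm (c N n) \<le> A * B * B" for N n
  proof (cases "- int N \<le> n \<and> n \<le> int N")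
    case True
    thus ?thesis unfolding c_eq[OF conjunct1[OF True] conjunct2[OF True]] norm_mult
      using A0 B0 by (intro mult_mono A B mult_nonneg_nonneg norm_ge_zero)
  qed (use A0 B0 in \<open>auto simp: c_def\<close>)
  have c_lim: "(\<lambda>N. c N n) \<longlonglongrightarrow> inverse ?L" for n
  proof (rule Lim_transform_eventually)
    have "filterlim (\<lambda>N. nat (int N + n)) at_top at_top" for n
      unfolding filterlim_at_top
    proof
      fix Z :: nat
      show "\<forall>\<^sub>F N in sequentially. Z \<le> nat (int N + n)"
        using eventually_ge_at_top[of "Z + nat \<bar>n\<bar>"] by eventually_elim auto
    qed
    from this[of n] this[of "-n"]
    have "(\<lambda>N. p (nat (int N + n))) \<longlonglongrightarrow> ?L" "(\<lambda>N. p (nat (int N - n))) \<longlonglongrightarrow> ?L"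
      using filterlim_compose[OF plim] by auto
    moreover have "(\<lambda>N. p (2 * N)) \<longlonglongrightarrow> ?L"
      using filterlim_compose[OF plim mult_nat_left_at_top[of 2]] by simp
    ultimately show "(\<lambda>N. p (2 * N) * inverse (p (nat (int N + n))) * inverse (p (nat (int N - n)))) \<longlonglongrightarrow> inverse ?L"
      using L by (auto intro!: tendsto_eq_intros)
    show "\<forall>\<^sub>F N in sequentially. p (2 * N) * inverse (p (nat (int N + n))) * inverse (p (nat (int N - n))) = c N n"
      using eventually_ge_at_top[of "nat \<bar>n\<bar>"] by eventually_elim (subst c_eq; auto)
  qed
  have f_sum: "f summable_on UNIV" unfolding f_def by (rule theta_summable_on[OF assms])
  \<comment> \<open>Tannery's theorem concerns series over the naturals, so the integers are
    enumerated by \<open>int_decode\<close>.\<close>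
  have enum: "infsum g UNIV = (\<Sum>k. g (int_decode k))" if "g summable_on UNIV" for g :: "int \<Rightarrow> complex"
  proof -
    have "(g has_sum infsum g UNIV) UNIV" using that by simp
    hence "((\<lambda>k. g (int_decode k)) has_sum infsum g UNIV) UNIV"
      using has_sum_reindex_bij_betw[OF bij_int_decode] by metis
    thus ?thesis by (metis has_sum_imp_sums sums_unique)
  qed
  have "(\<lambda>N. \<Sum>k. c N (int_decode k) * f (int_decode k)) \<longlonglongrightarrow> (\<Sum>k. inverse ?L * f (int_decode k))"
  proof (rule tannerys_theorem[THEN conjunct2, THEN conjunct2])
    show "(\<lambda>N. c N (int_decode k) * f (int_decode k)) \<longlonglongrightarrow> inverse ?L * f (int_decode k)" for k
      by (intro tendsto_mult c_lim tendsto_const)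
    show "\<forall>\<^sub>F (k, N) in at_top \<times>\<^sub>F sequentially.
        norm (c N (int_decode k) * f (int_decode k)) \<le> A * B * B * norm (f (int_decode k))"
      by (intro always_eventually) (auto simp: norm_mult intro!: mult_right_mono c_bound)
    have "(\<lambda>n. norm (f n)) summable_on UNIV"
      using f_sum by (simp add: summable_on_iff_abs_summable_on_complex)
    hence "(\<lambda>k. norm (f (int_decode k))) summable_on UNIV"
      using summable_on_reindex_bij_betw[OF bij_int_decode, of "\<lambda>n. norm (f n)"] by simp
    thus "summable (\<lambda>k. A * B * B * norm (f (int_decode k)))"
      by (intro summable_mult summable_on_imp_summable)
  qed auto
  also have "(\<Sum>k. inverse ?L * f (int_decode k)) = inverse ?L * theta z q"
    using enum[of "\<lambda>n. inverse ?L * f n"] f_sum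
    by (simp add: summable_on_cmult_right infsum_cmult_right' theta_def f_def)
  also have "(\<lambda>N. \<Sum>k. c N (int_decode k) * f (int_decode k)) =
    (\<lambda>N. (\<Prod>k<N. 1 - (- (z * q)) * (q\<^sup>2) ^ k) * (\<Prod>k<N. 1 - (- (q / z)) * (q\<^sup>2) ^ k))"
  proof
    fix N
    have fin: "((\<lambda>n. c N n * f n) has_sum (\<Sum>n\<in>{- int N..int N}. c N n * f n)) UNIV"
      by (rule has_sum_finite_neutralI[of "{- int N..int N}"]) (auto simp: c_def)
    have "(\<Sum>k. c N (int_decode k) * f (int_decode k)) = (\<Sum>n\<in>{- int N..int N}. c N n * f n)"
      using enum[of "\<lambda>n. c N n * f n"] fin by (simp add: has_sum_iff)
    also have "\<dots> = (\<Sum>j\<le>2*N. qbinom (q\<^sup>2) (2 * N) j * (z powi (int j - int N) * q powi (int j - int N)\<^sup>2))"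
      by (rule sum.reindex_bij_witness[of _ "\<lambda>j. int j - int N" "\<lambda>n. nat (n + int N)"])
         (auto simp: c_def f_def)
    finally show "(\<Sum>k. c N (int_decode k) * f (int_decode k)) =
      (\<Prod>k<N. 1 - (- (z * q)) * (q\<^sup>2) ^ k) * (\<Prod>k<N. 1 - (- (q / z)) * (q\<^sup>2) ^ k)"
      unfolding finite_jacobi_triple[OF assms] .
  qed
  finally have "inverse ?L * theta z q = qpoch_inf (- (z * q)) (q\<^sup>2) * qpoch_inf (- (q / z)) (q\<^sup>2)"
    by (rule LIMSEQ_unique) (intro tendsto_mult qpoch_inf_LIMSEQ q2)
  thus ?thesis using L by (simp add: field_simps)
qed

subsection \<open>Sums over the Gaussian integers modulo 2 + i\<close>

text \<open>Summability of complex families is absolute, so Fubini's theorem applies to the product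
  family.\<close>

lemma has_sum_times_int:
  fixes f g :: "int \<Rightarrow> complex"
  assumes "f summable_on UNIV" "g summable_on UNIV"
  shows "((\<lambda>(a, b). f a * g b) has_sum (infsum f UNIV * infsum g UNIV)) UNIV"
proof -
  have f: "(\<lambda>a. norm (f a)) summable_on UNIV" and g: "(\<lambda>a. norm (g a)) summable_on UNIV"
    using assms by (simp_all flip: summable_on_iff_abs_summable_on_complex)
  have "(\<lambda>x. norm (case x of (a, b) \<Rightarrow> f a * g b)) summable_on (UNIV \<times> UNIV)"
    using f g
    by (subst Infinite_Sum.abs_summable_on_Sigma_iff)
       (simp add: norm_mult summable_on_cmult_right summable_on_cmult_left infsum_cmult_right' abs_mult)
  hence "(\<lambda>(a, b). f a * g b) summable_on (UNIV \<times> UNIV)"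
    by (rule abs_summable_summable)
  moreover from infsum_Sigma'_banach[OF this]
  have "infsum (\<lambda>(a, b). f a * g b) (UNIV \<times> UNIV) = infsum f UNIV * infsum g UNIV"
    by (simp add: infsum_cmult_right' infsum_cmult_left')
  ultimately show ?thesis by (simp add: has_sum_iff)
qed

lemma theta_times_theta:
  assumes "norm q < 1" "q \<noteq> 0" "y \<noteq> 0" "z \<noteq> 0"
  shows "((\<lambda>(a, b). y powi a * z powi b * q powi (a\<^sup>2 + b\<^sup>2)) has_sum (theta y q * theta z q)) UNIV"
proof -
  have "(\<lambda>(a, b). (y powi a * q powi a\<^sup>2) * (z powi b * q powi b\<^sup>2)) =
        (\<lambda>(a, b). y powi a * z powi b * q powi (a\<^sup>2 + b\<^sup>2))"
    using assms by (simp add: power_int_add mult_ac)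
  thus ?thesis
    using has_sum_times_int[OF theta_summable_on[OF assms(1-3)] theta_summable_on[OF assms(1,2,4)]]
    by (simp add: theta_def)
qed

text \<open>The pair \<open>(a, b)\<close> stands for \<open>a + b i\<close>, whose class modulo \<open>2 + i\<close> is \<open>a - 2 b\<close> modulo 5. In the proof, the ideal
  consists of the \<open>(2 + i) (a + b i)\<close>, and multiplication by the unit \<open>i\<close> permutes the nonzero classes.\<close>

lemma theta_lattice_sum:
  fixes q :: complex and g :: "int \<Rightarrow> complex"
  assumes q: "norm q < 1" "q \<noteq> 0" and g: "\<And>n. g (n mod 5) = g n"
    and total: "((\<lambda>(a, b). g (a - 2 * b) * q powi (a\<^sup>2 + b\<^sup>2)) has_sum S) UNIV"
  shows "S = g 0 * (theta 1 (q ^ 5))\<^sup>2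
           + (g 1 + g 2 + g 3 + g 4) * (q * theta (q ^ 4) (q ^ 5) * theta (1 / q\<^sup>2) (q ^ 5))"
proof -
  define f where "f = (\<lambda>(a, b). q powi (a\<^sup>2 + b\<^sup>2))"
  define R where "R = (\<lambda>r. {(a :: int, b). (a - 2 * b) mod 5 = r})"
  have q5: "norm (q ^ 5) < 1" "q ^ 5 \<noteq> 0" using q by (simp_all add: norm_power power_less_one_iff)
  let ?A = "(theta 1 (q ^ 5))\<^sup>2" and ?B = "q * theta (q ^ 4) (q ^ 5) * theta (1 / q\<^sup>2) (q ^ 5)"
  have R0: "(f has_sum ?A) (R 0)"
  proof -
    have "((\<lambda>(a, b). (q ^ 5) powi (a\<^sup>2 + b\<^sup>2)) has_sum ?A) UNIV"
      using theta_times_theta[OF q5, of 1 1] by (simp add: power2_eq_square)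
    also have "?this \<longleftrightarrow> (f has_sum ?A) (R 0)"
    \<comment> \<open>Multiplication by \<open>2 + i\<close>, which multiplies the norm by 5. Its
      inverse multiplies by \<open>2 - i\<close> and divides by 5, exactly so on the ideal.\<close>
    proof (rule has_sum_reindex_bij_witness[of _ "\<lambda>(u, v). ((2 * u + v) div 5, (2 * v - u) div 5)"
          "\<lambda>(a, b). (2 * a - b, a + 2 * b)"], goal_cases)
      case (3 x)
      obtain u v where x: "x = (u, v)" by (cases x)
      with 3 have "5 dvd u - 2 * v" by (auto simp: R_def)
      then obtain k where u: "u = 2 * v + 5 * k" by (auto elim!: dvdE simp: algebra_simps)
      hence "2 * u + v = 5 * (v + 2 * k)" "2 * v - u = 5 * (- k)" by simp_all
      hence "(2 * u + v) div 5 = v + 2 * k" "(2 * v - u) div 5 = - k"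
        by (metis nonzero_mult_div_cancel_left zero_neq_numeral)+
      thus ?case by (simp add: x u)
    next
      case (5 x)
      obtain a b where x: "x = (a, b)" by (cases x)
      have "5 * (a\<^sup>2 + b\<^sup>2) = (2 * a - b)\<^sup>2 + (a + 2 * b)\<^sup>2" by (simp add: power2_eq_square algebra_simps)
      thus ?case using x by (simp add: f_def power_int_power)
    qed (auto simp: R_def)
    finally show ?thesis .
  qed
  have R1: "(f has_sum ?B) (R 1)"
  proof -
    have "((\<lambda>(a, b). q * ((q ^ 4) powi a * (1 / q\<^sup>2) powi b * (q ^ 5) powi (a\<^sup>2 + b\<^sup>2))) has_sum ?B) UNIV"
      using has_sum_cmult_right[OF theta_times_theta[OF q5, of "q ^ 4" "1 / q\<^sup>2"], of q] q
      by (simp add: case_prod_unfold mult_ac)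
    also have "?this \<longleftrightarrow> (f has_sum ?B) (R 1)"
    \<comment> \<open>The coset of 1 consists of the \<open>1 + (2 + i) (a + b i)\<close>. The
      linear part \<open>4 a - 2 b\<close> of their norm yields the arguments \<open>q ^ 4\<close>
      and \<open>1 / q\<^sup>2\<close>.\<close>
    proof (rule has_sum_reindex_bij_witness[of _ "\<lambda>(u, v). ((2 * u + v - 2) div 5, (2 * v - u + 1) div 5)"
          "\<lambda>(a, b). (2 * a - b + 1, a + 2 * b)"], goal_cases)
      case (3 x)
      obtain u v where x: "x = (u, v)" by (cases x)
      with 3 have "(u - 2 * v) mod 5 = 1" by (auto simp: R_def)
      moreover define k where "k = (u - 2 * v) div 5"
      ultimately have u: "u = 2 * v + 5 * k + 1" using mult_div_mod_eq[of 5 "u - 2 * v"] by simp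
      hence "2 * u + v - 2 = 5 * (v + 2 * k)" "2 * v - u + 1 = 5 * (- k)" by simp_all
      hence "(2 * u + v - 2) div 5 = v + 2 * k" "(2 * v - u + 1) div 5 = - k"
        by (metis nonzero_mult_div_cancel_left zero_neq_numeral)+
      thus ?case by (simp add: x u)
    next
      case (5 x)
      obtain a b where x: "x = (a, b)" by (cases x)
      have e: "(2 * a - b + 1)\<^sup>2 + (a + 2 * b)\<^sup>2 = 1 + 4 * a - 2 * b + 5 * (a\<^sup>2 + b\<^sup>2)"
        by (simp add: power2_eq_square algebra_simps)
      have "f (2 * a - b + 1, a + 2 * b) = q * (q ^ 4) powi a / (q\<^sup>2) powi b * (q ^ 5) powi (a\<^sup>2 + b\<^sup>2)"
        unfolding f_def prod.case e power_int_power using q by (simp add: power_int_add power_int_diff)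
      thus ?case using x by (simp add: power_int_divide_distrib)
    next
      case (2 x)
      obtain a b where x: "x = (a, b)" by (cases x)
      have "2 * a - b + 1 - 2 * (a + 2 * b) = 1 + 5 * (- b)" by simp
      hence "(2 * a - b + 1 - 2 * (a + 2 * b)) mod 5 = 1" by (simp only: mod_mult_self2) simp
      thus ?case unfolding x R_def by simp
    qed auto
    finally show ?thesis .
  qed
  \<comment> \<open>Multiplication by \<open>- i\<close> preserves the norm and doubles the class.
    As 2 generates the units modulo 5, the classes 2, 4 and 3 are reached from 1.\<close>
  have rot: "(f has_sum ?B) (R (2 * r mod 5))" if "(f has_sum ?B) (R r)" "r \<in> {0..<5}" for r
  proof -
    note that(1)
    also have "(f has_sum ?B) (R r) \<longleftrightarrow> (f has_sum ?B) (R (2 * r mod 5))"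
    proof (rule has_sum_reindex_bij_witness[of _ "\<lambda>(u, v). (- v, u)" "\<lambda>(u, v). (v, - u)"], goal_cases)
      case (2 x)
      obtain u v where x: "x = (u, v)" by (cases x)
      have "v - 2 * (- u) = 2 * (u - 2 * v) + 5 * v" by simp
      hence "(v - 2 * (- u)) mod 5 = 2 * ((u - 2 * v) mod 5) mod 5"
        by (simp only: mod_mult_self2 mod_mult_right_eq)
      also have "(u - 2 * v) mod 5 = r" using 2 by (simp add: x R_def)
      finally show ?case unfolding x R_def by simp
    next
      case (4 x)
      obtain u v where x: "x = (u, v)" by (cases x)
      have uv: "(u - 2 * v) mod 5 = 2 * r mod 5" using 4 by (simp add: x R_def)
      \<comment> \<open>The inverse map multiplies the class by 3, the inverse of 2 modulo
        5.\<close>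
      have "- v - 2 * u = 3 * (u - 2 * v) + 5 * (v - u)" by simp
      hence "(- v - 2 * u) mod 5 = 3 * ((u - 2 * v) mod 5) mod 5"
        by (simp only: mod_mult_self2 mod_mult_right_eq)
      also have "\<dots> = 3 * (2 * r) mod 5" unfolding uv by (rule mod_mult_right_eq)
      also have "3 * (2 * r) = r + 5 * r" by simp
      also have "\<dots> mod 5 = r"
        using that(2) by (simp only: mod_mult_self2 mod_pos_pos_trivial atLeastLessThan_iff)
      finally show ?case unfolding x R_def by simp
    qed (auto simp: f_def add_ac)
    finally show ?thesis .
  qed
  have R2: "(f has_sum ?B) (R 2)" using rot[OF R1] by simp
  have R4: "(f has_sum ?B) (R 4)" using rot[OF R2] by simp
  have R3: "(f has_sum ?B) (R 3)" using rot[OF R4] by simp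
  let ?h = "\<lambda>x :: int \<times> int. g (fst x - 2 * snd x) * f x"
  have tw: "(?h has_sum g r * T) (R r)" if "(f has_sum T) (R r)" for r T
  proof -
    have "((\<lambda>x. g r * f x) has_sum g r * T) (R r)" using that by (rule has_sum_cmult_right)
    also have "?this \<longleftrightarrow> ?thesis"
      by (rule has_sum_cong) (auto simp: R_def g)
    finally show ?thesis .
  qed
  have "(?h has_sum (g 0 * ?A + g 1 * ?B + g 2 * ?B + g 3 * ?B + g 4 * ?B)) (R 0 \<union> R 1 \<union> R 2 \<union> R 3 \<union> R 4)"
    by (intro has_sum_Un_disjoint tw R0 R1 R2 R3 R4) (auto simp: R_def)
  also have "R 0 \<union> R 1 \<union> R 2 \<union> R 3 \<union> R 4 = UNIV"
  proof -
    have "{0..<5} = {0, 1, 2, 3, 4 :: int}" by auto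
    hence "n mod 5 \<in> {0, 1, 2, 3, 4}" for n :: int using atLeastLessThan_iff[of "n mod 5" 0 5] by simp
    thus ?thesis by (auto simp: R_def)
  qed
  finally have "(?h has_sum (g 0 * ?A + (g 1 + g 2 + g 3 + g 4) * ?B)) UNIV"
    by (simp only: distrib_right add.assoc)
  moreover have "(?h has_sum S) UNIV"
    using total by (simp add: f_def case_prod_unfold)
  ultimately show ?thesis using has_sum_unique by blast
qed

subsection \<open>The quintic identities\<close>

definition chi :: "complex \<Rightarrow> complex" where
  "chi q = qpoch_inf (- q) (q\<^sup>2)"

lemma chi_nonzero: "norm q < 1 \<Longrightarrow> chi q \<noteq> 0"
  unfolding chi_def by (rule qpoch_inf_nonzero) (simp_all add: norm_power power_less_one_iff)

text \<open>Split \<open>qpoch_inf q q\<close> into odd and even exponents and use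
  \<open>(q;q\<^sup>2) (-q;q\<^sup>2) = (q\<^sup>2;q^4)\<close>. This rewrites the numerator and the
  denominator of \<open>P\<close>.\<close>

lemma chi_times_qpoch_inf:
  assumes "norm q < 1"
  shows "chi q * (qpoch_inf q q * qpoch_inf (q ^ 4) (q ^ 4)) = (qpoch_inf (q\<^sup>2) (q\<^sup>2))\<^sup>2"
proof -
  have q2: "norm (q\<^sup>2) < 1" using assms by (simp add: norm_power power_less_one_iff)
  have "qpoch_inf q q = qpoch_inf q (q\<^sup>2) * qpoch_inf (q\<^sup>2) (q\<^sup>2)"
    using qpoch_inf_dissect[OF assms, of 2 q] by (simp add: numeral_2_eq_2)
  moreover have "qpoch_inf (q\<^sup>2) (q\<^sup>2) = qpoch_inf (q\<^sup>2) (q ^ 4) * qpoch_inf (q ^ 4) (q ^ 4)"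
    using qpoch_inf_dissect[OF q2, of 2 "q\<^sup>2"]
    by (simp add: lessThan_Suc numeral_2_eq_2 flip: power_mult power_add) (simp add: mult_ac eval_nat_numeral)
  moreover have "qpoch_inf q (q\<^sup>2) * chi q = qpoch_inf (q\<^sup>2) (q ^ 4)"
    using qpoch_inf_mult_uminus[OF q2, of q] by (simp add: chi_def flip: power_mult)
  ultimately show ?thesis by (simp add: power2_eq_square mult_ac)
qed

lemma theta_1:
  assumes "norm q < 1" "q \<noteq> 0"
  shows "theta 1 q = qpoch_inf (q\<^sup>2) (q\<^sup>2) * (chi q)\<^sup>2"
  using jacobi_triple_product[OF assms, of 1] by (simp add: chi_def power2_eq_square)

text \<open>The triple products supply the exponents 1, 9, 3 and 7 modulo 10. Only the class 5 is
  missing from \<open>chi q\<close>, and it amounts to \<open>chi (q ^ 5)\<close>.\<close>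

lemma theta_q4_times_theta_inverse_q2:
  assumes "norm q < 1" "q \<noteq> 0"
  shows "theta (q ^ 4) (q ^ 5) * theta (1 / q\<^sup>2) (q ^ 5) = (qpoch_inf (q ^ 10) (q ^ 10))\<^sup>2 * chi q / chi (q ^ 5)"
proof -
  have q2: "norm (q\<^sup>2) < 1" and q5: "norm (q ^ 5) < 1" "q ^ 5 \<noteq> 0"
    using assms by (simp_all add: norm_power power_less_one_iff)
  have *: "q ^ 5 / q ^ 4 = q" "q ^ 5 / q\<^sup>2 = q ^ 3"
    using assms by (simp_all add: divide_simps flip: power_add power_Suc)
  have "theta (q ^ 4) (q ^ 5) =
      qpoch_inf (q ^ 10) (q ^ 10) * qpoch_inf (- (q ^ 9)) (q ^ 10) * qpoch_inf (- q) (q ^ 10)"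
    using jacobi_triple_product[OF q5, of "q ^ 4"] assms by (simp add: * flip: power_mult power_add)
  moreover have "theta (1 / q\<^sup>2) (q ^ 5) =
      qpoch_inf (q ^ 10) (q ^ 10) * qpoch_inf (- (q ^ 3)) (q ^ 10) * qpoch_inf (- (q ^ 7)) (q ^ 10)"
    using jacobi_triple_product[OF q5, of "1 / q\<^sup>2"] assms by (simp add: * flip: power_mult power_add)
  moreover have "chi q = qpoch_inf (- q) (q ^ 10) * qpoch_inf (- (q ^ 3)) (q ^ 10) * chi (q ^ 5) *
      qpoch_inf (- (q ^ 7)) (q ^ 10) * qpoch_inf (- (q ^ 9)) (q ^ 10)"
    using qpoch_inf_dissect[OF q2, of 5 "- q"]
    by (simp add: chi_def eval_nat_numeral mult_ac)
  ultimately show ?thesis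
    using chi_nonzero[OF q5(1)] by (simp add: field_simps power2_eq_square)
qed

lemma prod_fifth_roots:
  fixes \<zeta> x :: complex
  assumes "\<zeta> ^ 5 = 1" "1 + \<zeta> + \<zeta> ^ 2 + \<zeta> ^ 3 + \<zeta> ^ 4 = 0"
  shows "(1 + x) * (1 + \<zeta> * x) * (1 + \<zeta> ^ 4 * x) * (1 + \<zeta> ^ 3 * x) * (1 + \<zeta> ^ 2 * x) = 1 + x ^ 5"
  using assms by algebra

text \<open>The two triple products supply the factors twisted by \<open>\<zeta>\<close>,
  \<open>\<zeta> ^ 4\<close>, \<open>\<zeta> ^ 3\<close> and \<open>\<zeta>\<^sup>2\<close>, and
  \<open>chi q\<close> the untwisted one. Together they form \<open>1 + x ^ 5\<close> at each odd
  power \<open>x\<close> of \<open>q\<close>.\<close>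

lemma theta_fifth_roots:
  assumes "norm q < 1" "q \<noteq> 0" and \<zeta>: "\<zeta> ^ 5 = 1" "1 + \<zeta> + \<zeta> ^ 2 + \<zeta> ^ 3 + \<zeta> ^ 4 = 0"
  shows "theta \<zeta> q * theta (1 / \<zeta>\<^sup>2) q = (qpoch_inf (q\<^sup>2) (q\<^sup>2))\<^sup>2 * chi (q ^ 5) / chi q"
proof -
  have q2: "norm (q\<^sup>2) < 1" and q10: "norm ((q ^ 5)\<^sup>2) < 1"
    using assms by (simp_all add: norm_power power_less_one_iff flip: power_mult)
  have z0: "\<zeta> \<noteq> 0" using \<zeta>(1) by auto
  have inv: "q / \<zeta> = \<zeta> ^ 4 * q" "1 / \<zeta>\<^sup>2 = \<zeta> ^ 3" "q / \<zeta> ^ 3 = \<zeta>\<^sup>2 * q"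
    using z0 \<zeta>(1) by (simp_all add: field_simps flip: power_add power_Suc)
  have "chi q * qpoch_inf (- (\<zeta> * q)) (q\<^sup>2) * qpoch_inf (- (\<zeta> ^ 4 * q)) (q\<^sup>2) *
      qpoch_inf (- (\<zeta> ^ 3 * q)) (q\<^sup>2) * qpoch_inf (- (\<zeta>\<^sup>2 * q)) (q\<^sup>2) = chi (q ^ 5)"
  proof (rule LIMSEQ_unique)
    let ?p = "\<lambda>a n. \<Prod>k<n. 1 - a * (q\<^sup>2) ^ k"
    show "(\<lambda>n. ?p (- q) n * ?p (- (\<zeta> * q)) n * ?p (- (\<zeta> ^ 4 * q)) n * ?p (- (\<zeta> ^ 3 * q)) n * ?p (- (\<zeta>\<^sup>2 * q)) n)
      \<longlonglongrightarrow> chi q * qpoch_inf (- (\<zeta> * q)) (q\<^sup>2) * qpoch_inf (- (\<zeta> ^ 4 * q)) (q\<^sup>2) *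
      qpoch_inf (- (\<zeta> ^ 3 * q)) (q\<^sup>2) * qpoch_inf (- (\<zeta>\<^sup>2 * q)) (q\<^sup>2)"
      unfolding chi_def by (intro tendsto_mult qpoch_inf_LIMSEQ q2)
    have "1 - (- (q ^ 5)) * ((q ^ 5)\<^sup>2) ^ k = (1 - (- q) * (q\<^sup>2) ^ k) * (1 - (- (\<zeta> * q)) * (q\<^sup>2) ^ k) *
      (1 - (- (\<zeta> ^ 4 * q)) * (q\<^sup>2) ^ k) * (1 - (- (\<zeta> ^ 3 * q)) * (q\<^sup>2) ^ k) * (1 - (- (\<zeta>\<^sup>2 * q)) * (q\<^sup>2) ^ k)" for k
      using prod_fifth_roots[OF \<zeta>, of "q * (q\<^sup>2) ^ k"]
      by (simp add: power_mult_distrib mult_ac flip: power_mult)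
    hence "(\<lambda>n. ?p (- q) n * ?p (- (\<zeta> * q)) n * ?p (- (\<zeta> ^ 4 * q)) n * ?p (- (\<zeta> ^ 3 * q)) n * ?p (- (\<zeta>\<^sup>2 * q)) n)
      = (\<lambda>n. \<Prod>k<n. 1 - (- (q ^ 5)) * ((q ^ 5)\<^sup>2) ^ k)"
      by (simp only: prod.distrib)
    thus "(\<lambda>n. ?p (- q) n * ?p (- (\<zeta> * q)) n * ?p (- (\<zeta> ^ 4 * q)) n * ?p (- (\<zeta> ^ 3 * q)) n * ?p (- (\<zeta>\<^sup>2 * q)) n)
      \<longlonglongrightarrow> chi (q ^ 5)"
      unfolding chi_def by (simp only: qpoch_inf_LIMSEQ[OF q10])
  qed
  note chi_q5 = this[symmetric]
  have "\<zeta> ^ 3 \<noteq> 0" using z0 by simp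
  note jacobi = jacobi_triple_product[OF assms(1,2) z0] jacobi_triple_product[OF assms(1,2) this]
  show ?thesis
    unfolding inv(2) jacobi inv(1,3) chi_q5
    using chi_nonzero[OF assms(1)] by (simp add: power2_eq_square mult_ac)
qed

lemma theta_1_quintic:
  assumes "norm q < 1" "q \<noteq> 0"
  shows "(theta 1 q)\<^sup>2 - (theta 1 (q ^ 5))\<^sup>2 = 4 * q * (qpoch_inf (q ^ 10) (q ^ 10))\<^sup>2 * chi q / chi (q ^ 5)"
    and "5 * (theta 1 (q ^ 5))\<^sup>2 - (theta 1 q)\<^sup>2 = 4 * (qpoch_inf (q\<^sup>2) (q\<^sup>2))\<^sup>2 * chi (q ^ 5) / chi q"
proof -
  let ?B = "q * theta (q ^ 4) (q ^ 5) * theta (1 / q\<^sup>2) (q ^ 5)"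
  define \<zeta> where "\<zeta> = cis (2 * pi / 5)"
  have \<zeta>5: "\<zeta> ^ 5 = 1" unfolding \<zeta>_def Complex.DeMoivre by simp
  have "\<zeta> \<noteq> 1"
  proof
    assume "\<zeta> = 1"
    hence "cos (2 * pi / 5) = 1" unfolding \<zeta>_def by (metis cis.sel(1) one_complex.sel(1))
    moreover have "cos (2 * pi / 5) < cos 0" by (rule cos_monotone_0_pi) auto
    ultimately show False by simp
  qed
  moreover have "(\<zeta> - 1) * (1 + \<zeta> + \<zeta> ^ 2 + \<zeta> ^ 3 + \<zeta> ^ 4) = \<zeta> ^ 5 - 1" by algebra
  ultimately have sum0: "1 + \<zeta> + \<zeta> ^ 2 + \<zeta> ^ 3 + \<zeta> ^ 4 = 0" using \<zeta>5 by simp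
  have z0: "\<zeta> \<noteq> 0" by (simp add: \<zeta>_def)
  have 1: "(theta 1 q)\<^sup>2 = (theta 1 (q ^ 5))\<^sup>2 + 4 * ?B"
    using theta_lattice_sum[OF assms, of "\<lambda>_. 1"] theta_times_theta[OF assms, of 1 1]
    by (simp add: power2_eq_square)
  \<comment> \<open>The weight is the character \<open>\<zeta> powi (a - 2 * b)\<close>, which
    separates into powers of \<open>\<zeta>\<close> and \<open>1 / \<zeta>\<^sup>2\<close>; its
    values on the four nonzero classes add up to -1.\<close>
  have 2: "theta \<zeta> q * theta (1 / \<zeta>\<^sup>2) q = (theta 1 (q ^ 5))\<^sup>2 - ?B"
  proof -
    have per: "\<zeta> powi (n mod 5) = \<zeta> powi n" for n
    proof -
      have "\<zeta> powi n = \<zeta> powi (5 * (n div 5)) * \<zeta> powi (n mod 5)"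
        using z0 by (subst power_int_add[symmetric]) auto
      thus ?thesis by (simp add: power_int_mult \<zeta>5)
    qed
    have "\<zeta> powi (a - 2 * b) = \<zeta> powi a * (1 / \<zeta>\<^sup>2) powi b" for a b
      using z0 by (simp add: power_int_diff power_int_mult power_int_divide_distrib)
    hence "((\<lambda>(a, b). \<zeta> powi (a - 2 * b) * q powi (a\<^sup>2 + b\<^sup>2)) has_sum (theta \<zeta> q * theta (1 / \<zeta>\<^sup>2) q)) UNIV"
      using theta_times_theta[OF assms, of \<zeta> "1 / \<zeta>\<^sup>2"] z0 by simp
    from theta_lattice_sum[OF assms per this]
    have "theta \<zeta> q * theta (1 / \<zeta>\<^sup>2) q = (theta 1 (q ^ 5))\<^sup>2 + (\<zeta> + \<zeta>\<^sup>2 + \<zeta> ^ 3 + \<zeta> ^ 4) * ?B"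
      by simp
    moreover have "\<zeta> + \<zeta>\<^sup>2 + \<zeta> ^ 3 + \<zeta> ^ 4 = - 1" using sum0 by (simp add: add_eq_0_iff algebra_simps)
    ultimately show ?thesis by simp
  qed
  show "(theta 1 q)\<^sup>2 - (theta 1 (q ^ 5))\<^sup>2 = 4 * q * (qpoch_inf (q ^ 10) (q ^ 10))\<^sup>2 * chi q / chi (q ^ 5)"
    using 1 theta_q4_times_theta_inverse_q2[OF assms] by (simp add: mult.assoc)
  \<comment> \<open>With \<open>A\<close> the sum over the ideal and \<open>B\<close> that over one
    other coset, \<open>5 A - (A + 4 B) = 4 (A - B)\<close>.\<close>
  have "5 * (theta 1 (q ^ 5))\<^sup>2 - (theta 1 q)\<^sup>2 = 4 * (theta \<zeta> q * theta (1 / \<zeta>\<^sup>2) q)"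
    unfolding 1 2 by (simp add: algebra_simps)
  thus "5 * (theta 1 (q ^ 5))\<^sup>2 - (theta 1 q)\<^sup>2 = 4 * (qpoch_inf (q\<^sup>2) (q\<^sup>2))\<^sup>2 * chi (q ^ 5) / chi q"
    unfolding theta_fifth_roots[OF assms \<zeta>5 sum0] by simp
qed

subsection \<open>The modular equation\<close>

lemma modular_equation_of_parametrization:
  fixes x m w C :: complex
  assumes "x \<noteq> 0" "m \<noteq> 0" and curve: "x\<^sup>2 * m * (m - 1) = 5 - m"
    and w: "w = x + 1 / x" and C: "C = m\<^sup>2 * x ^ 3 + 25 / (m\<^sup>2 * x ^ 3)"
  shows "C\<^sup>2 = C * (w ^ 3 + 6 * w) - w ^ 4 - 37 * w\<^sup>2 + 64"
proof -
  define y where "y = 1 / x"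
  \<comment> \<open>\<open>-n\<close> is the other root of the quadratic \<open>curve\<close> for \<open>m\<close>\<close>
  define n where "n = 5 / (x\<^sup>2 * m)"
  \<comment> \<open>Obtained from the form of \<open>C\<close> derived below by exchanging
    \<open>m\<^sup>2\<close> and \<open>n\<^sup>2\<close>.\<close>
  define C' where "C' = x\<^sup>2 * (n\<^sup>2 * x + m\<^sup>2 * y)"
  have xy: "x * y = 1" using assms(1) by (simp add: y_def)
  have mn: "x\<^sup>2 * m * n = 5" using assms(1,2) by (simp add: n_def)
  \<comment> \<open>The sum of the roots \<open>m\<close> and \<open>- n\<close>, by Vieta.\<close>
  have "x\<^sup>2 * m * (m - n) = x\<^sup>2 * m * (1 - y\<^sup>2)" using curve mn xy by algebra
  hence d: "m - n = 1 - y\<^sup>2" using assms(1,2) by simp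
  \<comment> \<open>Since \<open>25 = (x\<^sup>2 * m * n)\<^sup>2\<close>, the second summand of
    \<open>C\<close> is \<open>n\<^sup>2 * x\<close>.\<close>
  have C: "C = x\<^sup>2 * (m\<^sup>2 * x + n\<^sup>2 * y)"
    unfolding C n_def y_def using assms(1,2) by (simp add: field_simps eval_nat_numeral)
  \<comment> \<open>From \<open>m\<^sup>2 + n\<^sup>2 = (m - n)\<^sup>2 + 2 * m * n\<close>; the
    right-hand side is \<open>w\<^sup>2 + 6\<close>.\<close>
  have sq: "x\<^sup>2 * (m\<^sup>2 + n\<^sup>2) = x\<^sup>2 + y\<^sup>2 + 8" using d mn xy by algebra
  have "C + C' = x\<^sup>2 * (m\<^sup>2 + n\<^sup>2) * (x + y)" unfolding C C'_def by algebra
  hence s: "C + C' = w ^ 3 + 6 * w" unfolding sq w y_def[symmetric] using xy by algebra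
  have "C * C' = (x\<^sup>2 * (m\<^sup>2 + n\<^sup>2))\<^sup>2 - 2 * (x\<^sup>2 * m * n)\<^sup>2 + (x\<^sup>2 * m * n)\<^sup>2 * (x\<^sup>2 + y\<^sup>2)"
    unfolding C C'_def using xy by algebra
  hence "C * C' = w ^ 4 + 37 * w\<^sup>2 - 64"
    unfolding sq mn w y_def[symmetric] using xy by algebra
  \<comment> \<open>\<open>C\<^sup>2 = (C + C') * C - C * C'\<close>.\<close>
  with s show ?thesis by algebra
qed

section \<open>Parametrization of the eta quotients\<close>

lemma ramanujan_f_uminus: "ramanujan_f (- x) = qpoch_inf x x"
  by (simp add: ramanujan_f_def)

lemma qpow_power: "qpow \<tau> r ^ n = qpow \<tau> (of_nat n * r)"
  by (simp add: qpow_def mult_ac flip: exp_of_nat_mult)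

text \<open>All quantities become monomials in \<open>F 2\<close>, \<open>F 10\<close>,
  \<open>chi q\<close>, \<open>chi (q ^ 5)\<close> and powers of the nome, up to constants; the
  quintic identities do this for \<open>m - 1\<close> and \<open>5 - m\<close>.\<close>

lemma eta_quotient_parametrization:
  fixes \<tau> q P Q :: complex
  assumes "Im \<tau> > 0"
    and "q = exp (2 * of_real pi * \<i> * \<tau>)"
    and "P = (ramanujan_f (- q) * ramanujan_f (- (q ^ 4))) /
             (qpow \<tau> (5 / 6) * ramanujan_f (- (q ^ 5)) * ramanujan_f (- (q ^ 20)))"
    and "Q = (ramanujan_f (- (q ^ 2)))\<^sup>2 /
             (qpow \<tau> (2 / 3) * (ramanujan_f (- (q ^ 10)))\<^sup>2)"
  obtains m where "m \<noteq> 0" "P / Q \<noteq> 0" "((P / Q) ^ 3)\<^sup>2 * m * (m - 1) = 5 - m"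
    "P * Q = m\<^sup>2 * ((P / Q) ^ 3) ^ 3"
proof -
  have q0: "q \<noteq> 0" and q1: "norm q < 1" using assms(1) by (simp_all add: assms(2))
  have q5: "norm (q ^ 5) < 1" "q ^ 5 \<noteq> 0"
    using q0 q1 by (simp_all add: norm_power power_less_one_iff)
  define F where "F = (\<lambda>k. qpoch_inf (q ^ k) (q ^ k))"
  have F: "F k \<noteq> 0" if "k > 0" for k
    unfolding F_def using q1 that
    by (intro qpoch_inf_nonzero) (simp_all add: norm_power power_less_one_iff)
  define X Y where "X = chi q" and "Y = chi (q ^ 5)"
  have X: "X \<noteq> 0" and Y: "Y \<noteq> 0"
    unfolding X_def Y_def using chi_nonzero q1 q5 by auto
  have F14: "F 1 * F 4 = (F 2)\<^sup>2 / X"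
    using chi_times_qpoch_inf[OF q1] X by (simp add: F_def X_def field_simps)
  have F520: "F 5 * F 20 = (F 10)\<^sup>2 / Y"
    using chi_times_qpoch_inf[OF q5(1)] Y by (simp add: F_def Y_def field_simps flip: power_mult)
  define a b where "a = F 2" and "b = F 10"
  have ab: "a \<noteq> 0" "b \<noteq> 0" using F by (auto simp: a_def b_def)
  define u v where "u = qpow \<tau> (5 / 6)" and "v = qpow \<tau> (2 / 3)"
  have uv: "u \<noteq> 0" "v \<noteq> 0" by (simp_all add: u_def v_def qpow_def)
  \<comment> \<open>Exponents of \<open>q\<close>: \<open>4 + 1 = 5\<close> here, and
    \<open>20 / 3\<close> on both sides of \<open>e2\<close>.\<close>
  have e1: "v ^ 6 * q = u ^ 6"
    unfolding u_def v_def qpow_power by (simp add: assms(2) qpow_def flip: exp_add)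
       (simp add: algebra_simps)
  have e2: "v ^ 10 = u ^ 8"
    unfolding u_def v_def qpow_power by simp
  have P: "P = a\<^sup>2 * Y / (u * b\<^sup>2 * X)"
  proof -
    have "P = (F 1 * F 4) / (u * (F 5 * F 20))"
      by (simp add: assms(3) ramanujan_f_uminus F_def u_def mult_ac)
    thus ?thesis unfolding F14 F520 using X Y by (simp add: a_def b_def)
  qed
  have Q: "Q = a\<^sup>2 / (v * b\<^sup>2)"
    by (simp add: assms(4) ramanujan_f_uminus F_def a_def b_def v_def)
  define s where "s = v * Y / (u * X)"
  have s: "s \<noteq> 0" using X Y uv by (simp add: s_def)
  have PQs: "P / Q = s" unfolding P Q s_def using ab X Y uv by (simp add: field_simps)
  define m where "m = (theta 1 q)\<^sup>2 / (theta 1 (q ^ 5))\<^sup>2"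
  have th: "theta 1 q = a * X\<^sup>2" "theta 1 (q ^ 5) = b * Y\<^sup>2"
    using theta_1[OF q1 q0] theta_1[OF q5] by (simp_all add: a_def b_def X_def Y_def F_def flip: power_mult)
  have m: "m = a\<^sup>2 * X ^ 4 / (b\<^sup>2 * Y ^ 4)"
    by (simp add: m_def th power_mult_distrib flip: power_mult)
  have th5: "theta 1 (q ^ 5) \<noteq> 0" using ab Y by (simp add: th)
  have m1: "m - 1 = 4 * q * X / Y ^ 5"
  proof -
    have "m - 1 = ((theta 1 q)\<^sup>2 - (theta 1 (q ^ 5))\<^sup>2) / (theta 1 (q ^ 5))\<^sup>2"
      using th5 by (simp add: m_def diff_divide_distrib)
    also have "\<dots> = (4 * q * b\<^sup>2 * X / Y) / (b * Y\<^sup>2)\<^sup>2"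
      unfolding theta_1_quintic(1)[OF q1 q0] unfolding th by (simp add: b_def F_def X_def Y_def)
    finally show ?thesis using ab Y by (simp add: field_simps eval_nat_numeral)
  qed
  have m5: "5 - m = 4 * a\<^sup>2 * Y / (X * b\<^sup>2 * Y ^ 4)"
  proof -
    have "5 - m = (5 * (theta 1 (q ^ 5))\<^sup>2 - (theta 1 q)\<^sup>2) / (theta 1 (q ^ 5))\<^sup>2"
      using th5 by (simp add: m_def diff_divide_distrib)
    also have "\<dots> = (4 * a\<^sup>2 * Y / X) / (b * Y\<^sup>2)\<^sup>2"
      unfolding theta_1_quintic(2)[OF q1 q0] unfolding th by (simp add: a_def F_def X_def Y_def)
    finally show ?thesis by (simp add: power_mult_distrib mult.assoc flip: power_mult)
  qed
  \<comment> \<open>By \<open>e1\<close> the fractional powers collapse to \<open>1 / q\<close>,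
    which cancels the \<open>q\<close> in \<open>m - 1\<close>.\<close>
  have "(s ^ 3)\<^sup>2 = (v ^ 6 * Y ^ 6) / (u ^ 6 * X ^ 6)"
    by (simp add: s_def power_divide power_mult_distrib flip: power_mult)
  also have "\<dots> = Y ^ 6 / (q * X ^ 6)" using e1[symmetric] uv q0 by (simp add: field_simps)
  finally have curve: "(s ^ 3)\<^sup>2 * m * (m - 1) = 5 - m"
    unfolding m1 m5 unfolding m using ab X Y q0 by (simp add: field_simps eval_nat_numeral)
  \<comment> \<open>Matches the fractional powers in \<open>(s ^ 3) ^ 3\<close> with the factor
    \<open>1 / (u * v)\<close> of \<open>P * Q\<close>.\<close>
  have "v ^ 9 * (u * v) = u * v ^ 10" by (simp add: eval_nat_numeral)
  also have "\<dots> = u ^ 9" unfolding e2 by (simp flip: power_Suc)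
  finally have vu: "v ^ 9 / u ^ 9 = 1 / (u * v)" using uv by (simp add: frac_eq_eq)
  have XY: "X ^ 9 = X ^ 8 * X" "Y ^ 9 = Y ^ 8 * Y"
    by (simp_all flip: power_Suc2)
  have "m\<^sup>2 * (s ^ 3) ^ 3 = (a ^ 4 * X ^ 8 / (b ^ 4 * Y ^ 8)) * (v ^ 9 / u ^ 9 * (Y ^ 9 / X ^ 9))"
    by (simp add: m s_def power_divide power_mult_distrib flip: power_mult)
  also have "\<dots> = P * Q"
    unfolding vu XY P Q using X Y by (simp add: power2_eq_square power4_eq_xxxx mult_ac)
  finally have "P * Q = m\<^sup>2 * (s ^ 3) ^ 3" ..
  moreover have "m \<noteq> 0" using ab X Y by (simp add: m)
  ultimately show ?thesis using that[of m] s curve unfolding PQs by blast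
qed

theorem theorem3p4:
  fixes \<tau> q P Q w C :: complex
  assumes "Im \<tau> > 0"
    and "q = exp (2 * of_real pi * \<i> * \<tau>)"
    and "P = (ramanujan_f (- q) * ramanujan_f (- (q ^ 4))) /
             (qpow \<tau> (5 / 6) * ramanujan_f (- (q ^ 5)) * ramanujan_f (- (q ^ 20)))"
    and "Q = (ramanujan_f (- (q ^ 2)))\<^sup>2 /
             (qpow \<tau> (2 / 3) * (ramanujan_f (- (q ^ 10)))\<^sup>2)"
    and "w = (P / Q) ^ 3 + (Q / P) ^ 3"
    and "C = P * Q + 25 / (P * Q)"
  shows "C\<^sup>2 = C * (w ^ 3 + 6 * w) - w ^ 4 - 37 * w\<^sup>2 + 64"
proof -
  obtain m where m: "m \<noteq> 0" "P / Q \<noteq> 0" "((P / Q) ^ 3)\<^sup>2 * m * (m - 1) = 5 - m"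
    "P * Q = m\<^sup>2 * ((P / Q) ^ 3) ^ 3"
    using eta_quotient_parametrization[OF assms(1-4)] .
  show ?thesis
  proof (rule modular_equation_of_parametrization[OF _ m(1,3)])
    show "(P / Q) ^ 3 \<noteq> 0" using m(2) by simp
    show "w = (P / Q) ^ 3 + 1 / (P / Q) ^ 3" unfolding assms(5) by (simp add: power_divide)
    show "C = m\<^sup>2 * ((P / Q) ^ 3) ^ 3 + 25 / (m\<^sup>2 * ((P / Q) ^ 3) ^ 3)"
      unfolding assms(6) m(4) ..
  qed
qed

end
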